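(* Any non-empty open subset $U$ of $[0,1]$ satisfies $\lambda^*(U \setminus \mathbb{Q}) = [0,1]$, and, consequently, $\lambda^*(U) = [0,1]$. In particular, the convergence exponent $\lambda^* \colon [0,1] \to [0,1]$ is surjective.
   Context: Pierce digits. For $x \in [0,1]$, define $d_1(x) := \lfloor 1/x \rfloor$ and $T(x) := 1 - d_1(x)\,x$ if $x \neq 0$, and $d_1(0) := \infty$, $T(0) := 0$. Here $\lfloor y \rfloor$ is the largest integer not exceeding $y$. For $n \in \mathbb{N} = \{1,2,3,\dots\}$ put $d_n(x) := d_1(T^{n-1}(x))$, where $T^{n-1}$ is the $(n-1)$-fold iterate of $T$ ($T^0$ is the identity). The sequence $(d_n(x))_{n \in \mathbb{N}}$ is the Pierce expansion digit sequence of $x$. Conventions: $\infty^s := \infty$ for $s>0$ and $c/\infty := 0$ for $c \in \mathbb{R}$. Convergence exponent: for $x \in [0,1]$, $\lambda^*(x) := \inf\{ s > 0 : \sum_{n \in \mathbb{N}} 1/(d_n(x))^s \text{ converges} \}$. The function $\lambda^*$ takes values in $[0,1]$. The interval $[0,1]$ carries the subspace topology induced by the standard topology of $\mathbb{R}$, and $\lambda^*(A)$ denotes the image of $A$ under $\lambda^*$. *)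

theory Defs
  imports "HOL-Analysis.Analysis" "HOL-Library.Extended_Nat"
begin

definition pierce_d1 :: "real \<Rightarrow> enat" where
  "pierce_d1 x = (if x = 0 then \<infinity> else enat (nat \<lfloor>1 / x\<rfloor>))"

definition pierce_T :: "real \<Rightarrow> real" where
  "pierce_T x = (if x = 0 then 0 else 1 - real_of_int \<lfloor>1 / x\<rfloor> * x)"

text \<open>Digits are numbered from 1; the value at index 0 is irrelevant and never used.\<close>

definition pierce_digit :: "nat \<Rightarrow> real \<Rightarrow> enat" where
  "pierce_digit n x = pierce_d1 ((pierce_T ^^ (n - 1)) x)"

text \<open>The real number \<open>1 / d\<^sup>s\<close> for \<open>s > 0\<close>, under the conventions
  \<open>\<infinity>\<^sup>s = \<infinity>\<close> and \<open>1 / \<infinity> = 0\<close>.\<close>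

definition inv_digit_powr :: "enat \<Rightarrow> real \<Rightarrow> real" where
  "inv_digit_powr d s = (case d of enat k \<Rightarrow> 1 / (real k powr s) | \<infinity> \<Rightarrow> 0)"

text \<open>For \<open>x \<in> [0,1]\<close> the finite digits are strictly increasing, so every \<open>s > 1\<close> belongs to
  the set below; it is nonempty and bounded below by 0, hence the real \<open>Inf\<close> is the genuine
  infimum.\<close>

definition conv_exponent :: "real \<Rightarrow> real" where
  "conv_exponent x =
     Inf {s. s > 0 \<and> summable (\<lambda>n. inv_digit_powr (pierce_digit (Suc n) x) s)}"

end

theory Submission imports Defs
begin

text \<open>
  The map \<open>z \<mapsto> (1 - z) / d\<close> inverts \<open>pierce_T\<close> on the set of points with first digit \<open>d\<close>.
  Iterating these inverse branches turns every strictly increasing sequence \<open>d\<close> of positive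
  integers into the alternating series \<open>1/d\<^sub>0 - 1/(d\<^sub>0 d\<^sub>1) + 1/(d\<^sub>0 d\<^sub>1 d\<^sub>2) - \<dots>\<close>, whose sum has
  exactly the digits \<open>d\<close> (\<open>pierce_digit_value\<close>).  The sum is irrational, because the
  expansion of a rational number stops: \<open>pierce_T\<close> sends \<open>p/q\<close> to \<open>(q mod p)/q\<close>, and numerators
  cannot decrease forever.

  The convergence exponent depends only on the tail of the digit sequence, while the position of
  a point is governed by its first digits: the branches do not expand distances, and after \<open>k\<close>
  steps every orbit lies in \<open>[0, 1/(k+1)]\<close>.  So one takes an irrational point \<open>y\<close> of the given
  open set, keeps its first \<open>k\<close> digits, and continues with the tail of a sequence of the
  prescribed exponent (\<open>value_close\<close>, \<open>admissible_splice\<close>).  For exponent \<open>\<alpha> > 0\<close> the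
  sequence \<open>\<lfloor>(n+1)\<^bsup>1/\<alpha>\<^esup>\<rfloor>\<close> serves, for exponent \<open>0\<close> the powers of two.

  Conversely, no exponent exceeds \<open>1\<close>, since the \<open>n\<close>-th digit of any point of the unit interval
  is at least \<open>n\<close>.
\<close>

section \<open>Orbits and digits\<close>

lemma pierce_d1_bounds:
  assumes "0 < x" "x \<le> 1"
  obtains d :: nat where "pierce_d1 x = enat d" "1 \<le> d" "real d * x \<le> 1" "1 < (real d + 1) * x"
    "pierce_T x = 1 - real d * x"
proof -
  have fl: "1 \<le> \<lfloor>1 / x\<rfloor>"
    using assms by simp
  define d where "d = nat \<lfloor>1 / x\<rfloor>"
  have d: "real d = of_int \<lfloor>1 / x\<rfloor>"
    unfolding d_def using fl by (intro of_nat_nat) linarith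
  have "real d \<le> 1 / x" "1 / x < real d + 1"
    unfolding d by linarith+
  then have "real d * x \<le> 1" "1 < (real d + 1) * x"
    using assms by (simp_all add: field_simps)
  moreover have "1 \<le> d" "pierce_d1 x = enat d"
    using fl assms d by (linarith, simp add: d_def pierce_d1_def)
  moreover have "pierce_T x = 1 - real d * x"
    using assms d by (simp add: pierce_T_def)
  ultimately show ?thesis
    using that by blast
qed

lemma pierce_d1_eqI:
  assumes "0 < x" "real d * x \<le> 1" "1 < (real d + 1) * x"
  shows "pierce_d1 x = enat d" "pierce_T x = 1 - real d * x"
proof -
  have "\<lfloor>1 / x\<rfloor> = int d"
    using assms by (intro floor_unique) (auto simp: field_simps)
  then show "pierce_d1 x = enat d" "pierce_T x = 1 - real d * x"
    using assms by (auto simp: pierce_d1_def pierce_T_def)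
qed

text \<open>A point \<open>x \<le> 1/(n+1)\<close> has first digit \<open>d \<ge> n+1\<close>, and then \<open>x > 1/(d+1)\<close> gives
  \<open>1 - d x < 1/(d+1) \<le> 1/(n+2)\<close>: each step of the orbit improves the bound by one.\<close>

lemma pierce_T_step:
  assumes "0 \<le> x" "(real n + 1) * x \<le> 1"
  shows "0 \<le> pierce_T x" "(real n + 2) * pierce_T x \<le> 1"
proof -
  have "0 \<le> pierce_T x \<and> (real n + 2) * pierce_T x \<le> 1"
  proof (cases "x = 0")
    case True
    then show ?thesis by (simp add: pierce_T_def)
  next
    case False
    then have x: "0 < x" using assms by simp
    have "1 * x \<le> (real n + 1) * x"
      using x by (intro mult_right_mono) auto
    then have "x \<le> 1" using assms by linarith
    with x obtain d where d: "1 \<le> d" "real d * x \<le> 1" "1 < (real d + 1) * x"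
      "pierce_T x = 1 - real d * x"
      by (rule pierce_d1_bounds)
    have "(real n + 1) * x < (real d + 1) * x" using d assms by linarith
    then have nd: "real n + 2 \<le> real d + 1" using x by simp
    have nn: "0 \<le> pierce_T x" using d by simp
    have "(real d + 1) * pierce_T x = (real d + 1) - real d * ((real d + 1) * x)"
      unfolding d(4) by (simp add: algebra_simps)
    also have "\<dots> \<le> (real d + 1) - real d * 1"
      using d by (intro diff_left_mono mult_left_mono) auto
    finally have "(real d + 1) * pierce_T x \<le> 1" by simp
    moreover have "(real n + 2) * pierce_T x \<le> (real d + 1) * pierce_T x"
      using nd nn by (rule mult_right_mono)
    ultimately show ?thesis using nn by linarith
  qed
  then show "0 \<le> pierce_T x" "(real n + 2) * pierce_T x \<le> 1" by auto
qed

lemma pierce_orbit_bounds: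
  assumes "x \<in> {0..1}"
  shows "0 \<le> (pierce_T ^^ n) x \<and> (real n + 1) * (pierce_T ^^ n) x \<le> 1"
proof (induction n)
  case 0
  then show ?case using assms by simp
next
  case (Suc n)
  then show ?case
    using pierce_T_step[of "(pierce_T ^^ n) x" n] by (simp add: add.commute)
qed

lemma pierce_orbit_le:
  assumes "x \<in> {0..1}"
  shows "(pierce_T ^^ n) x \<le> 1 / (real n + 1)"
  using pierce_orbit_bounds[OF assms, of n] by (simp add: field_simps)

lemma pierce_orbit_in_unit:
  assumes "x \<in> {0..1}"
  shows "(pierce_T ^^ n) x \<in> {0..1}"
proof -
  have "1 / (real n + 1) \<le> 1" by simp
  with pierce_orbit_le[OF assms, of n] have "(pierce_T ^^ n) x \<le> 1" by (rule order_trans)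
  then show ?thesis
    using pierce_orbit_bounds[OF assms, of n] by simp
qed

lemma inv_digit_powr_le:
  assumes x: "x \<in> {0..1}" and s: "0 < s"
  shows "inv_digit_powr (pierce_digit (Suc n) x) s \<le> 1 / real (Suc n) powr s"
proof (cases "(pierce_T ^^ n) x = 0")
  case True
  then show ?thesis by (simp add: pierce_digit_def pierce_d1_def inv_digit_powr_def)
next
  case False
  define z where "z = (pierce_T ^^ n) x"
  have "0 < z" "z \<le> 1"
    using False pierce_orbit_in_unit[OF x, of n] by (auto simp: z_def)
  then obtain d where d: "pierce_d1 z = enat d" "1 < (real d + 1) * z"
    by (rule pierce_d1_bounds)
  have "(real n + 1) * z \<le> 1"
    using pierce_orbit_bounds[OF x, of n] by (simp add: z_def)
  then have "(real n + 1) * z < (real d + 1) * z" using d by linarith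
  then have "Suc n \<le> d" using \<open>0 < z\<close> by simp
  then have "real (Suc n) powr s \<le> real d powr s"
    using s by (intro powr_mono2) auto
  then have "1 / real d powr s \<le> 1 / real (Suc n) powr s"
    using \<open>Suc n \<le> d\<close> by (intro divide_left_mono mult_pos_pos) auto
  then show ?thesis
    using d by (simp add: pierce_digit_def z_def inv_digit_powr_def)
qed

lemma inv_digit_powr_nonneg: "0 \<le> inv_digit_powr d s"
  by (simp add: inv_digit_powr_def split: enat.split)

lemma summable_inverse_Suc_powr: "summable (\<lambda>n. 1 / real (Suc n) powr s) \<longleftrightarrow> 1 < s"
proof -
  have "(\<lambda>n. 1 / real (Suc n) powr s) = (\<lambda>n. real (Suc n) powr (- s))"
    by (simp add: powr_minus_divide)
  then have "summable (\<lambda>n. 1 / real (Suc n) powr s) \<longleftrightarrow> summable (\<lambda>n. real n powr (- s))"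
    using summable_Suc_iff[of "\<lambda>n. real n powr (- s)"] by simp
  then show ?thesis by (simp add: summable_real_powr_iff)
qed

lemma conv_exponent_in_unit:
  assumes x: "x \<in> {0..1}"
  shows "conv_exponent x \<in> {0..1}"
proof -
  define S where "S = {s. s > 0 \<and> summable (\<lambda>n. inv_digit_powr (pierce_digit (Suc n) x) s)}"
  have gt1: "s \<in> S" if "1 < s" for s
  proof -
    have "summable (\<lambda>n. inv_digit_powr (pierce_digit (Suc n) x) s)"
    proof (rule summable_comparison_test)
      show "summable (\<lambda>n. 1 / real (Suc n) powr s)"
        using that summable_inverse_Suc_powr by blast
      show "\<exists>N. \<forall>n\<ge>N. norm (inv_digit_powr (pierce_digit (Suc n) x) s) \<le> 1 / real (Suc n) powr s"
        using inv_digit_powr_le[OF x] that by (simp add: inv_digit_powr_nonneg)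
    qed
    then show ?thesis using that by (simp add: S_def)
  qed
  have bdd: "bdd_below S" by (rule bdd_belowI[of _ 0]) (simp add: S_def)
  have "0 \<le> Inf S" using gt1[of 2]
    by (intro cInf_greatest) (force, simp add: S_def)
  moreover have "Inf S \<le> 1"
    by (rule dense_ge) (use gt1 bdd in \<open>auto intro: cInf_lower\<close>)
  ultimately show ?thesis by (simp add: conv_exponent_def S_def)
qed

section \<open>Rational points\<close>

lemma pierce_T_fraction:
  fixes p q :: nat
  assumes "0 < p" "0 < q"
  shows "pierce_T (real p / real q) = real (q mod p) / real q"
proof -
  have "\<lfloor>1 / (real p / real q)\<rfloor> = int (q div p)"
    by (simp add: floor_divide_of_nat_eq)
  then have "pierce_T (real p / real q) = 1 - real (q div p) * (real p / real q)"
    using assms by (simp add: pierce_T_def)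
  also have "\<dots> = (real q - real (q div p * p)) / real q"
    using assms by (simp add: field_simps)
  also have "real q - real (q div p * p) = real (q mod p)"
    by (metis add_diff_cancel_left' div_mult_mod_eq of_nat_add)
  finally show ?thesis .
qed

text \<open>The numerators \<open>p\<close>, \<open>q mod p\<close>, \dots over the fixed denominator \<open>q\<close> decrease strictly.\<close>

lemma pierce_orbit_fraction_terminates:
  fixes p q :: nat
  assumes "0 < q"
  shows "\<exists>n. (pierce_T ^^ n) (real p / real q) = 0"
proof (induction p rule: less_induct)
  case (less p)
  show ?case
  proof (cases "p = 0")
    case True
    then show ?thesis by (intro exI[of _ 0]) simp
  next
    case False
    then have "q mod p < p" by simp
    from less[OF this] obtain n where "(pierce_T ^^ n) (real (q mod p) / real q) = 0" ..
    then have "(pierce_T ^^ Suc n) (real p / real q) = 0"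
      using False assms by (simp add: funpow_Suc_right pierce_T_fraction del: funpow.simps)
    then show ?thesis ..
  qed
qed

lemma pierce_orbit_rational_terminates:
  assumes "x \<in> \<rat>" "0 \<le> x"
  shows "\<exists>n. (pierce_T ^^ n) x = 0"
proof -
  obtain p q :: nat where "q \<noteq> 0" "\<bar>x\<bar> = real p / real q"
    using assms(1) by (rule Rats_abs_nat_div_natE)
  then show ?thesis
    using pierce_orbit_fraction_terminates[of q p] assms(2) by simp
qed

lemma pierce_T_irrational:
  assumes "x \<in> {0..1}" "x \<notin> \<rat>"
  shows "pierce_T x \<notin> \<rat>"
proof
  assume T: "pierce_T x \<in> \<rat>"
  have "x \<noteq> 0" using assms by auto
  then have "0 < x" "x \<le> 1" using assms by auto
  then obtain d where d: "1 \<le> d" "pierce_T x = 1 - real d * x"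
    by (rule pierce_d1_bounds)
  then have "x = (1 - pierce_T x) / real d" by simp
  also have "\<dots> \<in> \<rat>" using T by simp
  finally show False using assms by simp
qed

lemma pierce_orbit_irrational:
  assumes "x \<in> {0..1}" "x \<notin> \<rat>"
  shows "(pierce_T ^^ n) x \<notin> \<rat>"
  by (induction n) (use assms pierce_T_irrational pierce_orbit_in_unit in auto)

section \<open>Points with prescribed digits\<close>

definition admissible :: "(nat \<Rightarrow> nat) \<Rightarrow> bool" where
  "admissible d \<longleftrightarrow> strict_mono d \<and> 0 < d 0"

definition pierce_value :: "(nat \<Rightarrow> nat) \<Rightarrow> real" where
  "pierce_value d = (\<Sum>n. (-1) ^ n * (1 / real (\<Prod>i\<le>n. d i)))"

lemma admissible_ge: "admissible d \<Longrightarrow> Suc n \<le> d n"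
proof (induction n)
  case (Suc n)
  then have "d n < d (Suc n)" by (simp add: admissible_def strict_mono_Suc_iff)
  then show ?case using Suc by simp
qed (simp add: admissible_def)

lemma admissible_shift: "admissible d \<Longrightarrow> admissible (\<lambda>n. d (n + k))"
  using admissible_ge[of d k] by (auto simp: admissible_def strict_mono_def)

lemma admissible_prod_pos: "admissible d \<Longrightarrow> 0 < (\<Prod>i\<le>n. d i)"
  by (intro prod_pos) (metis admissible_ge Suc_le_eq gr_zeroI not_less0)

text \<open>The reciprocal partial products decrease to \<open>0\<close>, so Leibniz' criterion applies.  Stopping
  after two terms yields the strict lower bound \<open>1/d\<^sub>0 - 1/(d\<^sub>0 d\<^sub>1) > 0\<close>.\<close>

lemma pierce_value_Leibniz:
  assumes d: "admissible d"
  shows "summable (\<lambda>n. (-1) ^ n * (1 / real (\<Prod>i\<le>n. d i)))" and "0 < pierce_value d"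
proof -
  define a where "a n = 1 / real (\<Prod>i\<le>n. d i)" for n
  have a_pos: "0 < a n" for n
    using admissible_prod_pos[OF d, of n] by (simp add: a_def del: of_nat_prod)
  have a_Suc: "a (Suc n) = a n / real (d (Suc n))" for n
    by (simp add: a_def)
  have a_dec: "a (Suc n) \<le> a n" for n
    using a_pos[of n] admissible_ge[OF d, of "Suc n"] by (simp add: a_Suc field_simps)
  have a_le: "a n \<le> 1 / real (Suc n)" for n
  proof (induction n)
    case 0
    then show ?case using admissible_ge[OF d, of 0] by (simp add: a_def field_simps)
  next
    case (Suc n)
    have "1 / real (Suc n) \<le> 1" by simp
    then have "a n \<le> 1" using Suc by linarith
    moreover have "1 / real (d (Suc n)) \<le> 1 / real (Suc (Suc n))"
      using admissible_ge[OF d, of "Suc n"] by (intro divide_left_mono) auto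
    ultimately have "a n * (1 / real (d (Suc n))) \<le> 1 * (1 / real (Suc (Suc n)))"
      using a_pos[of n] by (intro mult_mono) auto
    then show ?case by (simp add: a_Suc)
  qed
  have lim: "a \<longlonglongrightarrow> 0"
  proof (rule tendsto_sandwich[OF _ _ tendsto_const])
    show "(\<lambda>n. 1 / real (Suc n)) \<longlonglongrightarrow> 0"
      using LIMSEQ_inverse_real_of_nat by (simp add: inverse_eq_divide)
  qed (intro always_eventually allI a_le less_imp_le[OF a_pos])+
  have mono: "monoseq a" using a_dec by (intro decseq_imp_monoseq decseq_SucI)
  show "summable (\<lambda>n. (-1) ^ n * (1 / real (\<Prod>i\<le>n. d i)))"
    using summable_Leibniz(1)[OF lim mono] by (simp add: a_def)
  have "(\<Sum>i<2 * n. (-1) ^ i * a i) \<le> (\<Sum>i. (-1) ^ i * a i)" for n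
    using summable_Leibniz(2)[OF lim mono] a_pos[of 0] by auto
  from this[of 1] have "a 0 - a 1 \<le> pierce_value d"
    by (simp add: pierce_value_def a_def numeral_2_eq_2)
  moreover have "a 1 < a 0"
    using a_Suc[of 0] a_pos[of 0] admissible_ge[OF d, of 1] by (simp add: divide_less_eq)
  ultimately show "0 < pierce_value d" by linarith
qed

lemma pierce_value_unfold:
  assumes d: "admissible d"
  shows "pierce_value d = (1 - pierce_value (\<lambda>n. d (Suc n))) / real (d 0)"
proof -
  define f where "f n = (-1) ^ n * (1 / real (\<Prod>i\<le>n. d i))" for n
  define g where "g n = (-1) ^ n * (1 / real (\<Prod>i\<le>n. d (Suc i)))" for n
  have f: "summable f" unfolding f_def by (rule pierce_value_Leibniz[OF d])
  have g: "summable g"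
    unfolding g_def using pierce_value_Leibniz(1)[OF admissible_shift[OF d, of 1]] by simp
  have fg: "f (Suc n) = - g n / real (d 0)" for n
    by (simp add: f_def g_def prod.atMost_Suc_shift del: prod.atMost_Suc)
  have "pierce_value d = f 0 + (\<Sum>n. f (Suc n))"
    using suminf_split_head[OF f] unfolding pierce_value_def f_def by linarith
  also have "(\<Sum>n. f (Suc n)) = - (\<Sum>n. g n) / real (d 0)"
    unfolding fg using suminf_divide[OF summable_minus[OF g]] suminf_minus[OF g] by simp
  also have "f 0 = 1 / real (d 0)" by (simp add: f_def)
  finally show ?thesis by (simp add: pierce_value_def g_def diff_divide_distrib)
qed

lemma pierce_value_less:
  assumes d: "admissible d"
  shows "real (d 0) * pierce_value d < 1"
proof -
  have "0 < pierce_value (\<lambda>n. d (Suc n))"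
    using pierce_value_Leibniz(2)[OF admissible_shift[OF d, of 1]] by simp
  then show ?thesis
    using pierce_value_unfold[OF d] d by (simp add: admissible_def)
qed

lemma pierce_value_le:
  assumes d: "admissible d"
  shows "pierce_value (\<lambda>n. d (n + k)) \<le> 1 / (real k + 1)"
proof -
  let ?v = "pierce_value (\<lambda>n. d (n + k))"
  have v: "0 < ?v" "real (d k) * ?v < 1"
    using pierce_value_Leibniz(2) pierce_value_less admissible_shift[OF d, of k] by force+
  have "(real k + 1) * ?v \<le> real (d k) * ?v"
    using admissible_ge[OF d, of k] v by (intro mult_right_mono) auto
  then have "(real k + 1) * ?v \<le> 1" using v by linarith
  then show ?thesis by (simp add: field_simps)
qed

text \<open>The tail \<open>v\<close> of the series is below \<open>1/d\<^sub>1 \<le> 1/(d\<^sub>0+1)\<close>, which is exactly the condition for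
  \<open>(1 - v)/d\<^sub>0\<close> to exceed \<open>1/(d\<^sub>0+1)\<close>, that is, to have first digit \<open>d\<^sub>0\<close>.\<close>

lemma pierce_value_step:
  assumes d: "admissible d"
  shows "pierce_d1 (pierce_value d) = enat (d 0)"
    and "pierce_T (pierce_value d) = pierce_value (\<lambda>n. d (Suc n))"
proof -
  let ?v = "pierce_value (\<lambda>n. d (Suc n))"
  have d0: "0 < d 0" "d 0 < d 1" using d by (auto simp: admissible_def strict_mono_def)
  have v: "0 < ?v" "real (d 1) * ?v < 1"
    using pierce_value_Leibniz(2)[OF admissible_shift[OF d, of 1]]
      pierce_value_less[OF admissible_shift[OF d, of 1]] by simp_all
  have eq: "real (d 0) * pierce_value d = 1 - ?v"
    using pierce_value_unfold[OF d] d0 by simp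
  have "(real (d 0) + 1) * ?v \<le> real (d 1) * ?v"
    using d0 v by (intro mult_right_mono) auto
  then have "(real (d 0) + 1) * ?v < 1" using v by linarith
  then have "real (d 0) < (real (d 0) + 1) * (real (d 0) * pierce_value d)"
    unfolding eq by (simp add: algebra_simps)
  also have "\<dots> = real (d 0) * ((real (d 0) + 1) * pierce_value d)" by simp
  finally have lower: "1 < (real (d 0) + 1) * pierce_value d" using d0 by simp
  have "real (d 0) * pierce_value d \<le> 1" using pierce_value_less[OF d] by simp
  from pierce_d1_eqI[OF pierce_value_Leibniz(2)[OF d] this lower] eq
  show "pierce_d1 (pierce_value d) = enat (d 0)" "pierce_T (pierce_value d) = ?v"
    by simp_all
qed

lemma pierce_orbit_value:
  assumes d: "admissible d"
  shows "(pierce_T ^^ n) (pierce_value d) = pierce_value (\<lambda>i. d (i + n))"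
proof (induction n)
  case (Suc n)
  then show ?case using pierce_value_step(2)[OF admissible_shift[OF d, of n]] by simp
qed simp

lemma pierce_digit_value:
  assumes d: "admissible d"
  shows "pierce_digit (Suc n) (pierce_value d) = enat (d n)"
  using pierce_value_step(1)[OF admissible_shift[OF d, of n]]
  by (simp add: pierce_digit_def pierce_orbit_value[OF d])

lemma pierce_value_irrational:
  assumes d: "admissible d"
  shows "pierce_value d \<notin> \<rat>"
proof
  assume "pierce_value d \<in> \<rat>"
  then obtain n where "(pierce_T ^^ n) (pierce_value d) = 0"
    using pierce_orbit_rational_terminates pierce_value_Leibniz(2)[OF d] by force
  then show False
    using pierce_value_Leibniz(2)[OF admissible_shift[OF d, of n]] pierce_orbit_value[OF d, of n]
    by simp
qed

section \<open>Changing the tail of an expansion\<close>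

definition orbit_digit :: "real \<Rightarrow> nat \<Rightarrow> nat" where
  "orbit_digit y n = nat \<lfloor>1 / (pierce_T ^^ n) y\<rfloor>"

lemma orbit_digit_step:
  assumes y: "y \<in> {0..1}" "y \<notin> \<rat>"
  shows "0 < orbit_digit y n"
    and "(pierce_T ^^ n) y = (1 - (pierce_T ^^ Suc n) y) / real (orbit_digit y n)"
    and "orbit_digit y n < orbit_digit y (Suc n)"
proof -
  define z where "z = (pierce_T ^^ n) y"
  have irr: "(pierce_T ^^ k) y \<noteq> 0" for k
    using pierce_orbit_irrational[OF y, of k] by auto
  have unit: "0 < (pierce_T ^^ k) y" "(pierce_T ^^ k) y \<le> 1" for k
    using irr[of k] pierce_orbit_in_unit[OF y(1), of k] by auto
  obtain d where d: "pierce_d1 z = enat d" "1 \<le> d" "real d * z \<le> 1" "1 < (real d + 1) * z"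
    "pierce_T z = 1 - real d * z"
    using unit[of n] by (auto simp: z_def elim: pierce_d1_bounds)
  have od: "orbit_digit y n = d"
    using d(1) irr[of n] by (simp add: orbit_digit_def pierce_d1_def z_def)
  show pos: "0 < orbit_digit y n" using od d by simp
  show "(pierce_T ^^ n) y = (1 - (pierce_T ^^ Suc n) y) / real (orbit_digit y n)"
    using d od by (simp add: z_def)
  obtain e where e: "pierce_d1 (pierce_T z) = enat e" "1 < (real e + 1) * pierce_T z"
    using unit[of "Suc n"] by (auto simp: z_def elim: pierce_d1_bounds)
  have oe: "orbit_digit y (Suc n) = e"
    using e(1) irr[of "Suc n"] by (simp add: orbit_digit_def pierce_d1_def z_def)
  have Tpos: "0 < pierce_T z" using unit[of "Suc n"] by (simp add: z_def)
  have "(real (d - 1) + 1) * z \<le> 1" using d by simp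
  from pierce_T_step(2)[OF _ this] have "(real (d - 1) + 2) * pierce_T z \<le> 1"
    using unit[of n] by (simp add: z_def)
  moreover have "real (d - 1) + 2 = real d + 1" using d(2) by simp
  ultimately have "(real d + 1) * pierce_T z \<le> 1" by (simp only:)
  then have "(real d + 1) * pierce_T z < (real e + 1) * pierce_T z" using e by linarith
  then show "orbit_digit y n < orbit_digit y (Suc n)" using Tpos od oe by simp
qed

lemma admissible_splice:
  assumes y: "y \<in> {0..1}" "y \<notin> \<rat>" and f: "admissible f"
  shows "admissible (\<lambda>n. if n < k then orbit_digit y n else f (n + orbit_digit y k))"
proof -
  \<comment> \<open>The shift by \<open>orbit_digit y k\<close> makes the new digits larger than all the old ones.\<close>
  have "orbit_digit y n < f (Suc n + orbit_digit y k)" if "n < k" "\<not> Suc n < k" for n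
  proof -
    have "Suc n = k" using that by simp
    then show ?thesis
      using orbit_digit_step(3)[OF y, of n] admissible_ge[OF f, of "Suc n + orbit_digit y k"]
      by simp
  qed
  moreover have "f n < f (Suc n)" for n
    using f by (simp add: admissible_def strict_mono_Suc_iff)
  moreover have "0 < f (orbit_digit y k)"
    using admissible_ge[OF f, of "orbit_digit y k"] by simp
  ultimately show ?thesis
    unfolding admissible_def strict_mono_Suc_iff
    using orbit_digit_step(1,3)[OF y] by auto
qed

text \<open>Both points are obtained from their \<open>k\<close>-th iterates through the same \<open>k\<close> inverse branches
  \<open>z \<mapsto> (1 - z)/d\<close>, whose Lipschitz constants are at most \<open>1\<close>, and both iterates lie in
  \<open>[0, 1/(k+1)]\<close>.\<close>

lemma value_close:
  assumes y: "y \<in> {0..1}" "y \<notin> \<rat>" and c: "admissible c"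
    and agree: "\<And>n. n < k \<Longrightarrow> c n = orbit_digit y n"
  shows "\<bar>pierce_value c - y\<bar> \<le> 1 / (real k + 1)"
proof -
  let ?v = "\<lambda>n. pierce_value (\<lambda>i. c (i + n))"
  have "\<bar>pierce_value c - y\<bar> \<le> \<bar>?v n - (pierce_T ^^ n) y\<bar>" if "n \<le> k" for n
    using that
  proof (induction n)
    case (Suc n)
    let ?e = "real (orbit_digit y n)"
    have "c n = orbit_digit y n" using agree Suc by simp
    then have "?v n = (1 - ?v (Suc n)) / ?e"
      using pierce_value_unfold[OF admissible_shift[OF c, of n]] by simp
    then have "?v n - (pierce_T ^^ n) y = ((pierce_T ^^ Suc n) y - ?v (Suc n)) / ?e"
      using orbit_digit_step(2)[OF y, of n] by (simp add: diff_divide_distrib del: funpow.simps)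
    moreover have "\<bar>t / ?e\<bar> \<le> \<bar>t\<bar>" for t
      using orbit_digit_step(1)[OF y, of n] mult_left_mono[of 1 ?e "\<bar>t\<bar>"]
      by (simp add: abs_divide divide_le_eq)
    ultimately have "\<bar>?v n - (pierce_T ^^ n) y\<bar> \<le> \<bar>?v (Suc n) - (pierce_T ^^ Suc n) y\<bar>"
      by (metis abs_minus_commute)
    then show ?case using Suc by simp
  qed simp
  from this[of k] have "\<bar>pierce_value c - y\<bar> \<le> \<bar>?v k - (pierce_T ^^ k) y\<bar>" by simp
  moreover have "0 < ?v k" using pierce_value_Leibniz(2)[OF admissible_shift[OF c]] .
  moreover have "?v k \<le> 1 / (real k + 1)" by (rule pierce_value_le[OF c])
  ultimately show ?thesis
    using pierce_orbit_bounds[OF y(1), of k] pierce_orbit_le[OF y(1), of k] by linarith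
qed

section \<open>Digit sequences of prescribed exponent\<close>

lemma powr_plus_one_ge:
  fixes x p :: real
  assumes "1 \<le> x" "1 \<le> p"
  shows "x powr p + 1 \<le> (x + 1) powr p"
proof -
  have "x powr p = x * x powr (p - 1)"
    using assms by (simp add: powr_mult_base)
  moreover have "1 \<le> x powr (p - 1)"
    using assms by (simp add: ge_one_powr_ge_zero)
  ultimately have "x powr p + 1 \<le> (x + 1) * x powr (p - 1)"
    by (simp add: algebra_simps)
  also have "\<dots> \<le> (x + 1) * (x + 1) powr (p - 1)"
    using assms by (intro mult_left_mono powr_mono2) auto
  also have "\<dots> = (x + 1) powr p"
    using assms by (simp add: powr_mult_base)
  finally show ?thesis .
qed

text \<open>With \<open>p = 1/\<alpha> \<ge> 1\<close>, consecutive values of \<open>(n+1)\<^bsup>p\<^esup>\<close> are at least \<open>1\<close> apart, so their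
  integer parts still increase strictly.  Taking integer parts changes a number \<open>\<ge> 1\<close> by a factor
  of at most \<open>2\<close>, so the series behaves like the sum of \<open>(n+1)\<^bsup>-s/\<alpha>\<^esup>\<close>.\<close>

lemma power_growth_sequence:
  assumes "0 < \<alpha>" "\<alpha> \<le> 1"
  shows "\<exists>f. admissible f \<and> (\<forall>s>0. summable (\<lambda>n. 1 / real (f n) powr s) \<longleftrightarrow> \<alpha> < s)"
proof -
  define p where "p = 1 / \<alpha>"
  have p: "1 \<le> p" using assms by (simp add: p_def)
  define g where "g n = real (Suc n) powr p" for n
  define f where "f n = nat \<lfloor>g n\<rfloor>" for n
  have g1: "1 \<le> g n" for n
    unfolding g_def using p by (intro ge_one_powr_ge_zero) auto
  have g_Suc: "g n + 1 \<le> g (Suc n)" for n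
    using powr_plus_one_ge[of "real (Suc n)" p] p by (simp add: g_def add.commute)
  have f_real: "real (f n) = of_int \<lfloor>g n\<rfloor>" for n
    using g1[of n] by (simp add: f_def)
  have f_le: "real (f n) \<le> g n" for n
    unfolding f_real by simp
  have f_ge: "g n / 2 \<le> real (f n)" for n
  proof -
    have "1 \<le> \<lfloor>g n\<rfloor>" using g1[of n] by simp
    then have "1 \<le> real (f n)" unfolding f_real by simp
    moreover have "g n < real (f n) + 1" unfolding f_real by linarith
    ultimately show ?thesis by linarith
  qed
  have f_pos: "0 < real (f n)" for n
    using f_ge[of n] g1[of n] by linarith
  have "admissible f"
    unfolding admissible_def strict_mono_Suc_iff
  proof (intro conjI allI)
    fix n
    have "\<lfloor>g n\<rfloor> + 1 \<le> \<lfloor>g (Suc n)\<rfloor>"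
      using g_Suc[of n] by linarith
    then have "real (f n) + 1 \<le> real (f (Suc n))"
      unfolding f_real by linarith
    then show "f n < f (Suc n)" by linarith
  qed (use f_pos[of 0] in simp)
  moreover have "summable (\<lambda>n. 1 / real (f n) powr s) \<longleftrightarrow> \<alpha> < s" if s: "0 < s" for s
  proof -
    let ?h = "\<lambda>n. 1 / real (Suc n) powr (p * s)"
    have h: "?h n = 1 / g n powr s" for n
      by (simp add: g_def powr_powr)
    have lower: "?h n \<le> 1 / real (f n) powr s" for n
      unfolding h using f_le[of n] f_pos[of n] s
      by (intro divide_left_mono powr_mono2 mult_pos_pos) auto
    have upper: "1 / real (f n) powr s \<le> 2 powr s * ?h n" for n
    proof -
      have "(g n / 2) powr s \<le> real (f n) powr s"
        using f_ge[of n] g1[of n] s by (intro powr_mono2) auto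
      then have "1 / real (f n) powr s \<le> 1 / (g n / 2) powr s"
        using f_pos[of n] g1[of n] by (intro divide_left_mono mult_pos_pos) auto
      also have "\<dots> = 2 powr s * ?h n"
        unfolding h using g1[of n] by (simp add: powr_divide)
      finally show ?thesis .
    qed
    have "summable (\<lambda>n. 1 / real (f n) powr s) \<longleftrightarrow> summable ?h"
    proof
      assume "summable (\<lambda>n. 1 / real (f n) powr s)"
      then show "summable ?h"
        by (rule summable_comparison_test'[where N = 0]) (use lower in simp)
    next
      assume "summable ?h"
      then have "summable (\<lambda>n. 2 powr s * ?h n)" by (rule summable_mult)
      then show "summable (\<lambda>n. 1 / real (f n) powr s)"
        by (rule summable_comparison_test'[where N = 0]) (use upper in simp)
    qed
    also have "\<dots> \<longleftrightarrow> 1 < p * s" by (rule summable_inverse_Suc_powr)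
    also have "\<dots> \<longleftrightarrow> \<alpha> < s" using assms by (simp add: p_def field_simps)
    finally show ?thesis .
  qed
  ultimately show ?thesis by blast
qed

lemma exponential_growth_sequence:
  "\<exists>f. admissible f \<and> (\<forall>s>0. summable (\<lambda>n. 1 / real (f n) powr s))"
proof (intro exI conjI allI impI)
  show "admissible (\<lambda>n. 2 ^ n)" by (simp add: admissible_def strict_mono_Suc_iff)
  fix s :: real assume s: "0 < s"
  have "1 / real (2 ^ n) powr s = (1 / 2 powr s) ^ n" for n
    by (simp add: power_one_over powr_powr powr_realpow[symmetric] mult.commute powr_power)
  moreover have "norm (1 / 2 powr s) < 1" using s by simp
  ultimately show "summable (\<lambda>n. 1 / real (2 ^ n) powr s)"
    by (simp add: summable_geometric)
qed

lemma sequence_of_exponent: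
  assumes "\<alpha> \<in> {0..1}"
  obtains f where "admissible f"
    "\<And>s. 0 < s \<Longrightarrow> summable (\<lambda>n. 1 / real (f n) powr s) \<longleftrightarrow> \<alpha> < s"
proof (cases "\<alpha> = 0")
  case True
  then show ?thesis using exponential_growth_sequence that by auto
next
  case False
  then show ?thesis using power_growth_sequence[of \<alpha>] assms that by auto
qed

section \<open>The convergence exponent on open sets\<close>

lemma irrational_in_openin:
  assumes "openin (top_of_set {0..1::real}) U" "U \<noteq> {}"
  obtains y \<epsilon> where "y \<in> {0..1}" "y \<notin> \<rat>" "0 < \<epsilon>" "ball y \<epsilon> \<subseteq> U"
proof -
  obtain W where W: "open W" "U = {0..1} \<inter> W"
    using assms(1) by (auto simp: openin_open)
  have op: "open (W \<inter> {0<..<1})" using W by auto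
  \<comment> \<open>An end point of the unit interval is a limit of interior points.\<close>
  have "W \<inter> closure {0<..<1} \<noteq> {}"
    using W assms(2) by auto
  then have ne: "W \<inter> {0<..<1} \<noteq> {}"
    using W open_Int_closure_eq_empty by blast
  obtain y where y: "y \<in> W \<inter> {0<..<1}" "y \<notin> \<rat>"
    using open_minus_countable[OF countable_rat ne op] by blast
  from op y(1) obtain \<epsilon> where "0 < \<epsilon>" "ball y \<epsilon> \<subseteq> W \<inter> {0<..<1}"
    by (rule openE)
  moreover from this have "ball y \<epsilon> \<subseteq> U" using W by force
  ultimately show ?thesis using that[of y \<epsilon>] y by auto
qed

lemma conv_exponent_value:
  assumes c: "admissible c" and \<alpha>: "0 \<le> \<alpha>"
    and sum: "\<And>s. 0 < s \<Longrightarrow> summable (\<lambda>n. 1 / real (c n) powr s) \<longleftrightarrow> \<alpha> < s"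
  shows "conv_exponent (pierce_value c) = \<alpha>"
proof -
  have "{s. s > 0 \<and> summable (\<lambda>n. inv_digit_powr (pierce_digit (Suc n) (pierce_value c)) s)}
      = {\<alpha><..}"
    using sum \<alpha> by (auto simp: pierce_digit_value[OF c] inv_digit_powr_def)
  then show ?thesis by (simp add: conv_exponent_def)
qed

lemma exponent_attained_in_openin:
  assumes U: "openin (top_of_set {0..1::real}) U" "U \<noteq> {}" and \<alpha>: "\<alpha> \<in> {0..1}"
  shows "\<exists>x \<in> U - \<rat>. conv_exponent x = \<alpha>"
proof -
  obtain y \<epsilon> where y: "y \<in> {0..1}" "y \<notin> \<rat>" and \<epsilon>: "0 < \<epsilon>" "ball y \<epsilon> \<subseteq> U"
    using irrational_in_openin[OF U] by blast
  obtain f where f: "admissible f"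
    and sum_f: "\<And>s. 0 < s \<Longrightarrow> summable (\<lambda>n. 1 / real (f n) powr s) \<longleftrightarrow> \<alpha> < s"
    using sequence_of_exponent[OF \<alpha>] by blast
  obtain k where k: "1 / (real k + 1) < \<epsilon>"
    using nat_approx_posE[OF \<epsilon>(1)] by (metis of_nat_Suc add.commute)
  define m where "m = orbit_digit y k"
  define c where "c n = (if n < k then orbit_digit y n else f (n + m))" for n
  have c: "admissible c"
    unfolding c_def m_def by (rule admissible_splice[OF y f])
  have "summable (\<lambda>n. 1 / real (c n) powr s) \<longleftrightarrow> \<alpha> < s" if "0 < s" for s
  proof -
    have "summable (\<lambda>n. 1 / real (c n) powr s) \<longleftrightarrow> summable (\<lambda>n. 1 / real (c (n + k)) powr s)"
      using summable_iff_shift[of "\<lambda>n. 1 / real (c n) powr s" k] by simp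
    also have "\<dots> \<longleftrightarrow> summable (\<lambda>n. 1 / real (f (n + (k + m))) powr s)"
      by (simp add: c_def add.assoc)
    also have "\<dots> \<longleftrightarrow> summable (\<lambda>n. 1 / real (f n) powr s)"
      using summable_iff_shift[of "\<lambda>n. 1 / real (f n) powr s" "k + m"] by simp
    finally show ?thesis using sum_f[OF that] by simp
  qed
  then have "conv_exponent (pierce_value c) = \<alpha>"
    using c \<alpha> by (intro conv_exponent_value) auto
  moreover have "\<bar>pierce_value c - y\<bar> < \<epsilon>"
    using value_close[OF y c, of k] k by (simp add: c_def)
  then have "pierce_value c \<in> U"
    using \<epsilon>(2) by (auto simp: dist_real_def abs_minus_commute)
  ultimately show ?thesis
    using pierce_value_irrational[OF c] by blast
qed

theorem theorem1p2:
  shows "(\<forall>U. openin (top_of_set {0..1::real}) U \<and> U \<noteq> {} \<longrightarrow>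
            conv_exponent ` (U - \<rat>) = {0..1} \<and> conv_exponent ` U = {0..1}) \<and>
         conv_exponent ` {0..1} = {0..1}"
proof -
  have main: "conv_exponent ` (U - \<rat>) = {0..1} \<and> conv_exponent ` U = {0..1}"
    if U: "openin (top_of_set {0..1::real}) U" "U \<noteq> {}" for U
  proof -
    have "conv_exponent ` U \<subseteq> {0..1}"
      using openin_imp_subset[OF U(1)] conv_exponent_in_unit by blast
    moreover have "{0..1} \<subseteq> conv_exponent ` (U - \<rat>)"
      using exponent_attained_in_openin[OF U] by (metis image_eqI subsetI)
    ultimately show ?thesis by blast
  qed
  moreover have "openin (top_of_set {0..1::real}) {0..1}" by simp
  ultimately show ?thesis by (metis atLeastatMost_empty_iff zero_le_one)
qed

end
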